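(* Let $\mu$, $\nu$, $B$ be as in the context. Let $K$ be the nonempty compact set defined by $K=\bigcup_{i\in B}S_i(K)$, with the convention that $K=\emptyset$ if $B=\emptyset$. Then, for every $\alpha>0$, $$E_\alpha(\mu)=\left(E_\alpha(\nu)\cap([0,1]\setminus K)\right)\cup\left(E_\alpha(\mu)\cap K\right).$$
   Context: Let $\ell\ge 2$ be an integer. For $0\le i\le \ell-1$ define $S_i,S_{i+\ell}:[0,1]\to[0,1]$ by $S_i(x)=\frac{x}{\ell}+\frac{i}{\ell}$ and $S_{i+\ell}(x)=-\frac{x}{\ell}+\frac{i+1}{\ell}$. Let $(p_i)_{0\le i\le 2\ell-1}$ be a probability weight ($p_i\ge 0$, $\sum_i p_i=1$) with $p_i>0$ for every $0\le i\le\ell-1$, and let $\mu$ be the unique Borel probability measure on $[0,1]$ with $\mu=\sum_{i=0}^{2\ell-1}p_i\,\mu\circ S_i^{-1}$. Let $T(x)=1-x$, $\nu=(\mu+\mu\circ T)/2$ and $B=\{0\le i\le\ell-1: p_{i+\ell}=0\}$. $\mathcal{F}_n$ is the set of $\ell$-adic intervals $[k/\ell^n,(k+1)/\ell^n)$, $0\le k<\ell^n$; $I_n(x)$ is the element of $\mathcal{F}_n$ containing $x$ (with $I_n(1)$ the last interval, $k=\ell^n-1$). For a probability measure $m$ on $[0,1]$, $E_\alpha(m)=\left\{x\in[0,1]: \lim_{n\to\infty}-\frac{\log m(I_n(x))}{n\log\ell}=\alpha\right\}$. *)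

theory Defs
  imports "HOL-Probability.Probability"
begin

definition borel01 :: "real measure" where
  "borel01 = restrict_space borel {0..1}"

definition branch :: "nat \<Rightarrow> nat \<Rightarrow> real \<Rightarrow> real" where
  "branch l i x = (if i < l then x / real l + real i / real l
              else - (x / real l) + (real (i - l) + 1) / real l)"

definition reflect :: "real \<Rightarrow> real" where
  "reflect x = 1 - x"

text \<open>In \<open>distr \<mu> borel01 (branch l i)\<close> the map \<open>branch l i\<close> acts on the space \<open>{0..1}\<close> of \<open>\<mu>\<close>,
  so this is the measure \<open>\<mu> \<circ> S\<^sub>i\<^sup>-\<^sup>1\<close> on the unit interval.\<close>

definition self_similar_measure :: "nat \<Rightarrow> (nat \<Rightarrow> real) \<Rightarrow> real measure \<Rightarrow> bool" where
  "self_similar_measure l p \<mu> \<longleftrightarrow>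
     prob_space \<mu> \<and> sets \<mu> = sets borel01 \<and>
     (\<forall>A \<in> sets borel01.
        emeasure \<mu> A = (\<Sum>i<2*l. ennreal (p i) * emeasure (distr \<mu> borel01 (branch l i)) A))"

definition symmetrization :: "real measure \<Rightarrow> real measure" where
  "symmetrization \<mu> = measure_of (space \<mu>) (sets \<mu>) (\<lambda>A. (emeasure \<mu> A + emeasure \<mu> (reflect ` A)) / 2)"

definition zero_flip_digits :: "nat \<Rightarrow> (nat \<Rightarrow> real) \<Rightarrow> nat set" where
  "zero_flip_digits l p = {i. i < l \<and> p (i + l) = 0}"

definition is_attractor :: "nat \<Rightarrow> nat set \<Rightarrow> real set \<Rightarrow> bool" where
  "is_attractor l B K \<longleftrightarrow>
     (if B = {} then K = {}
      else K \<noteq> {} \<and> compact K \<and> K \<subseteq> {0..1} \<and> K = (\<Union>i\<in>B. branch l i ` K))"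

definition adic_intervals :: "nat \<Rightarrow> nat \<Rightarrow> real set set" where
  "adic_intervals l n = {{real k / real l ^ n ..< (real k + 1) / real l ^ n} | k. k < l ^ n}"

definition adic_interval_at :: "nat \<Rightarrow> nat \<Rightarrow> real \<Rightarrow> real set" where
  "adic_interval_at l n x =
     (if x = 1 then {(real l ^ n - 1) / real l ^ n ..< 1}
      else (THE J. J \<in> adic_intervals l n \<and> x \<in> J))"

text \<open>The convention \<open>- log 0 = \<infinity>\<close> is made explicit, since \<open>ln 0 = 0\<close> in HOL.\<close>

definition neg_log :: "real \<Rightarrow> ereal" where
  "neg_log r = (if r = 0 then \<infinity> else ereal (- ln r))"

definition level_set :: "nat \<Rightarrow> real measure \<Rightarrow> real \<Rightarrow> real set" where
  "level_set l m \<alpha> =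
     {x \<in> {0..1}. (\<lambda>n. neg_log (measure m (adic_interval_at l n x)) / ereal (real n * ln (real l)))
                    \<longlonglongrightarrow> ereal \<alpha>}"

lemma space_borel01: "space borel01 = {0..1}"
  by (simp add: borel01_def space_restrict_space)

lemma reflect_measurable: "reflect \<in> borel01 \<rightarrow>\<^sub>M borel01"
  unfolding borel01_def reflect_def
  by (auto intro!: measurable_restrict_space3 borel_measurable_diff)

lemma branch_measurable: "i < 2 * l \<Longrightarrow> branch l i \<in> borel01 \<rightarrow>\<^sub>M borel01"
proof -
  assume i: "i < 2 * l"
  have bounds: "branch l i x \<in> {0..1}" if "x \<in> {0..1}" for x
  proof (cases "i < l")
    case True
    then have "x + real i \<le> real l" "0 \<le> x" using that by auto
    with True show ?thesis by (simp add: branch_def field_simps)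
  next
    case False
    have "branch l i x = (real (i - l) + 1 - x) / real l"
      using False by (simp add: branch_def diff_divide_distrib)
    moreover have "real (i - l) + 1 - x \<le> real l" "0 \<le> real (i - l) + 1 - x" "0 < real l"
      using False that i by auto
    ultimately show ?thesis by simp
  qed
  have "branch l i \<in> borel \<rightarrow>\<^sub>M borel"
    unfolding branch_def by measurable
  with bounds show ?thesis
    unfolding borel01_def by (auto intro!: measurable_restrict_space3)
qed

lemma emeasure_symmetrization:
  assumes "sets \<mu> = sets borel01" and A: "A \<in> sets borel01"
  shows "emeasure (symmetrization \<mu>) A = (emeasure \<mu> A + emeasure \<mu> (reflect ` A)) / 2"
proof -
  have sp: "space \<mu> = {0..1}"
    using sets_eq_imp_space_eq[OF assms(1)] by (simp add: space_borel01)
  have img: "reflect ` C = reflect -` C \<inter> space \<mu>" if "C \<in> sets \<mu>" for C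
  proof -
    have "C \<subseteq> {0..1}" using sets.sets_into_space[OF that] sp by simp
    then show ?thesis unfolding sp by (force simp: reflect_def image_iff)
  qed
  have Tm: "reflect \<in> \<mu> \<rightarrow>\<^sub>M \<mu>"
    using reflect_measurable measurable_cong_sets[OF assms(1) assms(1)] by blast
  have d: "emeasure \<mu> (reflect ` C) = emeasure (distr \<mu> \<mu> reflect) C" if "C \<in> sets \<mu>" for C
    using img[OF that] emeasure_distr[OF Tm that] by simp
  show ?thesis
    unfolding symmetrization_def
  proof (rule emeasure_measure_of_sigma)
    show "sigma_algebra (space \<mu>) (sets \<mu>)" by (rule sets.sigma_algebra_axioms)
    show "positive (sets \<mu>) (\<lambda>A. (emeasure \<mu> A + emeasure \<mu> (reflect ` A)) / 2)"
      by (simp add: positive_def)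
    show "A \<in> sets \<mu>" using A assms(1) by simp
    show "countably_additive (sets \<mu>) (\<lambda>A. (emeasure \<mu> A + emeasure \<mu> (reflect ` A)) / 2)"
    proof (rule countably_additiveI)
      fix F :: "nat \<Rightarrow> real set"
      assume F: "range F \<subseteq> sets \<mu>" "disjoint_family F" "(\<Union>i. F i) \<in> sets \<mu>"
      have "(\<Sum>i. (emeasure \<mu> (F i) + emeasure \<mu> (reflect ` F i)) / 2)
          = (\<Sum>i. emeasure \<mu> (F i) + emeasure (distr \<mu> \<mu> reflect) (F i)) / 2"
        using F(1) by (subst ennreal_suminf_divide) (auto simp: d range_subsetD)
      also have "(\<Sum>i. emeasure \<mu> (F i) + emeasure (distr \<mu> \<mu> reflect) (F i))
          = (\<Sum>i. emeasure \<mu> (F i)) + (\<Sum>i. emeasure (distr \<mu> \<mu> reflect) (F i))"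
        by (rule suminf_add[symmetric]) auto
      also have "\<dots> = emeasure \<mu> (\<Union>i. F i) + emeasure (distr \<mu> \<mu> reflect) (\<Union>i. F i)"
        using F by (simp add: suminf_emeasure)
      finally show "(\<Sum>i. (emeasure \<mu> (F i) + emeasure \<mu> (reflect ` F i)) / 2)
          = (emeasure \<mu> (\<Union>i. F i) + emeasure \<mu> (reflect ` (\<Union>i. F i))) / 2"
        using d[OF F(3)] by simp
    qed
  qed
qed

lemma adic_interval_unique:
  assumes "0 < l" "0 \<le> x" "x < 1"
  shows "\<exists>!J. J \<in> adic_intervals l n \<and> x \<in> J"
proof -
  have L: "0 < real l ^ n" using assms(1) by simp
  have mem: "x \<in> {real k / real l ^ n ..< (real k + 1) / real l ^ n} \<longleftrightarrow> k = nat \<lfloor>x * real l ^ n\<rfloor>" for k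
  proof -
    have "x \<in> {real k / real l ^ n ..< (real k + 1) / real l ^ n}
        \<longleftrightarrow> real k \<le> x * real l ^ n \<and> x * real l ^ n < real k + 1"
      using L by (simp add: divide_le_eq less_divide_eq)
    also have "\<dots> \<longleftrightarrow> \<lfloor>x * real l ^ n\<rfloor> = int k"
      by (simp add: floor_eq_iff)
    also have "\<dots> \<longleftrightarrow> k = nat \<lfloor>x * real l ^ n\<rfloor>"
      using assms L by auto
    finally show ?thesis .
  qed
  have "nat \<lfloor>x * real l ^ n\<rfloor> < l ^ n"
  proof -
    have "x * real l ^ n < real (l ^ n)" using assms L by simp
    then have "\<lfloor>x * real l ^ n\<rfloor> < int (l ^ n)" by (simp only: floor_less_iff of_int_of_nat_eq)
    then show ?thesis using assms(1) by (metis nat_0_iff nat_int zless_nat_conj of_nat_0_less_iff zero_less_power)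
  qed
  moreover define J where
    "J = (\<lambda>k. {real k / real l ^ n ..< (real k + 1) / real l ^ n})"
  ultimately have "\<exists>!X. X \<in> {J k | k. k < l ^ n} \<and> x \<in> X"
    using mem by (intro ex1I[of _ "J (nat \<lfloor>x * real l ^ n\<rfloor>)"]) (auto simp del: atLeastLessThan_iff)
  then show ?thesis
    unfolding adic_intervals_def J_def .
qed

end

theory Submission
  imports Defs
begin

text \<open>
  Points of \<open>K\<close> contribute identically to both sides, so the claim is that for \<open>x \<notin> K\<close> the
  measures \<open>\<mu> (I\<^sub>n x)\<close> and \<open>\<nu> (I\<^sub>n x)\<close> are comparable for all large \<open>n\<close>, up to constants
  depending on \<open>x\<close> only; comparable sequences have the same exponential decay rate (\<open>neg_log_rate_cong\<close>).

  One inequality, \<open>\<mu> \<le> 2 \<nu>\<close>, is trivial. For the other, write \<open>T\<close> for the reflection and \<open>S\<^sub>w\<close>,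
  \<open>w < l\<close>, for the orientation preserving branches. Two facts about a Borel set \<open>A \<subseteq> [0,1]\<close>
  suffice:

  \<^item> \<open>\<mu> (S\<^sub>w A) \<ge> p\<^sub>w \<mu> A + p\<^bsub>w+l\<^esub> \<mu> (T A)\<close>, because \<open>S\<^bsub>w+l\<^esub> \<circ> T = S\<^sub>w\<close>;
  \<^item> \<open>\<mu> (S\<^sub>w A \<union> T S\<^sub>w A) \<le> \<mu> (A \<union> T A)\<close>, because every branch preimage of the set on the left lies in
    \<open>A \<union> T A\<close>. This holds even at the endpoints where neighbouring branches meet, so that no
    discussion of atoms of \<open>\<mu>\<close> is required.

  If the \<open>l\<close>-adic expansion of \<open>x\<close> has a digit \<open>w \<notin> B\<close>, that is \<open>p\<^bsub>w+l\<^esub> > 0\<close>, then at this digit the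
  first fact bounds \<open>\<mu> (S\<^sub>w A)\<close> below by a positive multiple of \<open>\<mu> (A \<union> T A)\<close>, and each
  earlier digit \<open>v\<close> only costs the factor \<open>p\<^sub>v > 0\<close> (\<open>self_similar_comparable_at\<close>).
  If all digits of \<open>x\<close> lie in \<open>B\<close>, then \<open>x\<close> is a limit of points of the compact set \<open>K\<close>, hence in \<open>K\<close> (\<open>attractor_mem_if_digits\<close>).
\<close>

section \<open>Digits and adic intervals\<close>

text \<open>The first \<open>l\<close>-adic digit of a point of the unit interval. The point \<open>1\<close> is given the digits
  \<open>l - 1\<close> throughout, in accordance with its adic intervals being the last ones.\<close>

definition first_digit :: "nat \<Rightarrow> real \<Rightarrow> nat" where
  "first_digit l x = (if x = 1 then l - 1 else nat \<lfloor>real l * x\<rfloor>)"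

text \<open>The shift on \<open>l\<close>-adic expansions, deleting the first digit.\<close>

definition digit_shift :: "nat \<Rightarrow> real \<Rightarrow> real" where
  "digit_shift l x = real l * x - real (first_digit l x)"

lemma first_digit_less:
  assumes "0 < l" "x \<in> {0..1}"
  shows "first_digit l x < l"
proof (cases "x = 1")
  case True
  then show ?thesis using assms by (simp add: first_digit_def)
next
  case False
  then have "real l * x < real l" using assms by simp
  then have "\<lfloor>real l * x\<rfloor> < int l" by (simp add: floor_less_iff)
  then show ?thesis using assms False by (simp add: first_digit_def nat_less_iff)
qed

lemma digit_shift_less_1:
  assumes "x \<in> {0..1}" "x \<noteq> 1"
  shows "digit_shift l x \<in> {0..<1}"
proof -
  have "real (first_digit l x) = real_of_int \<lfloor>real l * x\<rfloor>"
    using assms by (simp add: first_digit_def)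
  then show ?thesis by (simp add: digit_shift_def) linarith
qed

lemma digit_shift_1: "0 < l \<Longrightarrow> digit_shift l 1 = 1"
  by (simp add: digit_shift_def first_digit_def of_nat_diff)

lemma digit_shift_mem:
  assumes "0 < l" "x \<in> {0..1}"
  shows "digit_shift l x \<in> {0..1}"
  using digit_shift_less_1[of x l] digit_shift_1[of l] assms by (cases "x = 1") auto

lemma branch_digit_shift:
  assumes "0 < l" "x \<in> {0..1}"
  shows "branch l (first_digit l x) (digit_shift l x) = x"
  using first_digit_less[OF assms] assms(1)
  by (simp add: branch_def digit_shift_def field_simps)

lemma branch_image_atLeastLessThan:
  assumes "i < l"
  shows "branch l i ` {a..<b} = {branch l i a..<branch l i b}"
proof -
  have l: "0 < real l" using assms by simp
  have "y \<in> branch l i ` {a..<b}" if "y \<in> {branch l i a..<branch l i b}" for y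
  proof (rule image_eqI)
    show "y = branch l i (real l * y - real i)"
      using assms l by (simp add: branch_def field_simps)
    show "real l * y - real i \<in> {a..<b}"
      using that assms l by (simp add: branch_def field_simps)
  qed
  then show ?thesis
    using assms l by (auto simp: branch_def divide_strict_right_mono divide_right_mono)
qed

lemma adic_interval_at_mem:
  assumes "0 < l" "x \<in> {0..1}"
  shows "adic_interval_at l n x \<in> adic_intervals l n"
proof (cases "x = 1")
  case True
  have "real (l ^ n - 1) = real l ^ n - 1" using assms(1) by (simp add: of_nat_diff)
  then show ?thesis
    using assms(1) True unfolding adic_intervals_def adic_interval_at_def
    by (intro CollectI exI[of _ "l ^ n - 1"]) simp
next
  case False
  with theI'[OF adic_interval_unique[of l x n]] assms show ?thesis
    by (simp add: adic_interval_at_def)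
qed

lemma adic_interval_at_Suc:
  assumes "0 < l" "x \<in> {0..1}"
  shows "adic_interval_at l (Suc n) x =
    branch l (first_digit l x) ` adic_interval_at l n (digit_shift l x)"
proof (cases "x = 1")
  case True
  then show ?thesis using assms(1)
    by (simp add: adic_interval_at_def digit_shift_1 branch_image_atLeastLessThan first_digit_def)
      (simp add: branch_def field_simps of_nat_diff)
next
  case False
  define w where "w = first_digit l x"
  define y where "y = digit_shift l x"
  have w: "w < l" using first_digit_less[OF assms] by (simp add: w_def)
  have y: "y \<in> {0..<1}" using digit_shift_less_1[OF assms(2) False] by (simp add: y_def)
  have x: "branch l w y = x" using branch_digit_shift[OF assms] by (simp add: w_def y_def)
  let ?J = "adic_interval_at l n y"
  have "?J \<in> adic_intervals l n \<and> y \<in> ?J"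
    using theI'[OF adic_interval_unique[of l y n]] y assms(1) by (simp add: adic_interval_at_def)
  then obtain k where k: "k < l ^ n" "?J = {real k / real l ^ n ..< (real k + 1) / real l ^ n}"
    and yJ: "y \<in> ?J" unfolding adic_intervals_def by auto
  have "k + w * l ^ n < l ^ Suc n"
  proof -
    have "k + w * l ^ n < Suc w * l ^ n" using k(1) by simp
    also have "\<dots> \<le> l * l ^ n" using w by (intro mult_right_mono) auto
    finally show ?thesis by simp
  qed
  moreover have "branch l w ` ?J =
      {real (k + w * l ^ n) / real l ^ Suc n ..< (real (k + w * l ^ n) + 1) / real l ^ Suc n}"
    unfolding k(2) branch_image_atLeastLessThan[OF w]
    using w assms(1) by (simp add: branch_def field_simps)
  ultimately have "branch l w ` ?J \<in> adic_intervals l (Suc n)"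
    unfolding adic_intervals_def by blast
  moreover have "x \<in> branch l w ` ?J" using yJ x by blast
  moreover have "\<exists>!J. J \<in> adic_intervals l (Suc n) \<and> x \<in> J"
    using adic_interval_unique assms False by simp
  ultimately have "(THE J. J \<in> adic_intervals l (Suc n) \<and> x \<in> J) = branch l w ` ?J"
    by (intro the1_equality) auto
  then show ?thesis using False by (simp add: adic_interval_at_def w_def y_def)
qed

lemma sets_borel01: "A \<in> sets borel01 \<longleftrightarrow> A \<in> sets borel \<and> A \<subseteq> {0..1}"
  by (auto simp: borel01_def sets_restrict_space_iff)

lemma adic_intervals_sets:
  assumes "0 < l" "J \<in> adic_intervals l n"
  shows "J \<in> sets borel01"
proof -
  obtain k where k: "k < l ^ n" "J = {real k / real l ^ n ..< (real k + 1) / real l ^ n}"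
    using assms(2) unfolding adic_intervals_def by auto
  have "real (Suc k) \<le> real (l ^ n)" using k(1) by (intro of_nat_mono) simp
  then have "(real k + 1) / real l ^ n \<le> 1" using assms(1) by simp
  then have "J \<subseteq> {0..1}" unfolding k(2)
    by (smt (verit) atLeastLessThan_iff atLeastAtMost_iff divide_nonneg_nonneg of_nat_0_le_iff subsetI zero_le_power)
  then show ?thesis using k(2) by (simp add: sets_borel01)
qed

lemma adic_interval_at_sets:
  assumes "0 < l" "x \<in> {0..1}"
  shows "adic_interval_at l n x \<in> sets borel01"
  using adic_intervals_sets[OF assms(1) adic_interval_at_mem[OF assms]] .

section \<open>Points all of whose digits lie in a given set\<close>

text \<open>Composing the branches of the first \<open>n\<close> digits of \<open>x\<close> carries a point of \<open>K\<close> to a point of \<open>K\<close>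
  within \<open>l\<^sup>-\<^sup>n\<close> of \<open>x\<close>; hence \<open>x\<close> lies in the closed set \<open>K\<close>.\<close>

lemma attractor_mem_if_digits:
  assumes l: "2 \<le> l" and K: "is_attractor l B K" and B: "B \<subseteq> {..<l}"
    and x: "x \<in> {0..1}" and digits: "\<And>k. first_digit l ((digit_shift l ^^ k) x) \<in> B"
  shows "x \<in> K"
proof -
  have "B \<noteq> {}" using digits by blast
  then have K': "K \<noteq> {}" "compact K" "K \<subseteq> {0..1}" "K = (\<Union>i\<in>B. branch l i ` K)"
    using K unfolding is_attractor_def by (auto split: if_splits)
  have approx: "\<exists>y\<in>K. \<bar>y - x\<bar> \<le> (1 / real l) ^ n"
    if "x \<in> {0..1}" "\<And>k. first_digit l ((digit_shift l ^^ k) x) \<in> B" for x n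
    using that
  proof (induction n arbitrary: x)
    case 0
    obtain y where "y \<in> K" using K'(1) by blast
    then show ?case using 0 K'(3) by (intro bexI[of _ y]) (auto simp: abs_le_iff)
  next
    case (Suc n)
    define w where "w = first_digit l x"
    have w: "w \<in> B" "w < l" using Suc.prems(2)[of 0] B by (auto simp: w_def)
    have x': "branch l w (digit_shift l x) = x"
      using branch_digit_shift[of l x] Suc.prems(1) l by (simp add: w_def)
    have "\<exists>y\<in>K. \<bar>y - digit_shift l x\<bar> \<le> (1 / real l) ^ n"
    proof (rule Suc.IH)
      show "digit_shift l x \<in> {0..1}" using digit_shift_mem Suc.prems(1) l by simp
      show "first_digit l ((digit_shift l ^^ k) (digit_shift l x)) \<in> B" for k
        using Suc.prems(2)[of "Suc k"] by (simp only: funpow_Suc_right o_apply)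
    qed
    then obtain y where y: "y \<in> K" "\<bar>y - digit_shift l x\<bar> \<le> (1 / real l) ^ n" by blast
    have "branch l w y \<in> K" using K'(4) w(1) y(1) by blast
    moreover have "\<bar>branch l w y - x\<bar> = \<bar>y - digit_shift l x\<bar> / real l"
      by (subst x'[symmetric]) (use w(2) in \<open>simp add: branch_def flip: diff_divide_distrib\<close>)
    then have "\<bar>branch l w y - x\<bar> \<le> (1 / real l) ^ Suc n"
      using divide_right_mono[OF y(2), of "real l"] by (simp add: power_one_over mult.commute)
    ultimately show ?case by blast
  qed
  have "x \<in> closure K"
  proof (subst closure_approachable, intro allI impI)
    fix e :: real assume "0 < e"
    moreover have "(\<lambda>n. (1 / real l) ^ n) \<longlonglongrightarrow> 0"
      using l by (intro LIMSEQ_realpow_zero) auto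
    ultimately have "\<forall>\<^sub>F n in sequentially. (1 / real l) ^ n < e"
      by (simp add: order_tendstoD(2))
    then obtain n where "(1 / real l) ^ n < e"
      by (auto simp: eventually_sequentially)
    with approx[OF x digits, of n] show "\<exists>y\<in>K. dist y x < e"
      by (auto simp: dist_real_def intro: le_less_trans)
  qed
  then show ?thesis using K'(2) by (simp add: compact_imp_closed)
qed

section \<open>Self-similar measures and reflection\<close>

lemma reflect_image_eq: "reflect ` A = {x. reflect x \<in> A}"
  by (force simp: reflect_def image_iff)

lemma reflect_sets:
  assumes "A \<in> sets borel01"
  shows "reflect ` A \<in> sets borel01"
proof -
  have "reflect ` A = reflect -` A \<inter> space borel01"
    using assms by (auto simp: reflect_image_eq sets_borel01 space_borel01) (auto simp: reflect_def)
  then show ?thesis using measurable_sets[OF reflect_measurable assms] by simp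
qed

lemma branch_mem:
  assumes "i < 2 * l" "x \<in> {0..1}"
  shows "branch l i x \<in> {0..1}"
  using measurable_space[OF branch_measurable[OF assms(1)]] assms(2) by (simp add: space_borel01)

lemma branch_sets:
  assumes "i < l" "A \<in> sets borel01"
  shows "branch l i ` A \<in> sets borel01"
proof -
  have "branch l i ` A = (\<lambda>y. real l * y - real i) -` A \<inter> space borel"
  proof (intro set_eqI iffI)
    fix y assume "y \<in> (\<lambda>y. real l * y - real i) -` A \<inter> space borel"
    then show "y \<in> branch l i ` A"
      using assms(1) by (intro image_eqI[of _ _ "real l * y - real i"]) (auto simp: branch_def field_simps)
  qed (use assms(1) in \<open>auto simp: branch_def field_simps\<close>)
  moreover have "(\<lambda>y. real l * y - real i) \<in> borel \<rightarrow>\<^sub>M borel" by measurable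
  ultimately have "branch l i ` A \<in> sets borel"
    using assms(2) measurable_sets[of "\<lambda>y. real l * y - real i" borel borel A]
    by (simp add: sets_borel01)
  moreover have "branch l i ` A \<subseteq> {0..1}"
    using assms branch_mem[of i l] by (auto simp: sets_borel01)
  ultimately show ?thesis by (simp add: sets_borel01)
qed

text \<open>All branches agree up to reflection of the argument and translation by multiples of \<open>1 / l\<close>. The
  common endpoints of neighbouring branches are no exception, since \<open>0\<close> and \<open>1\<close> are reflections
  of each other.\<close>

lemma branch_eq_branch_cases:
  assumes "i < 2 * l" "w < l" "x \<in> {0..1}" "y \<in> {0..1}" "branch l i x = branch l w y"
  shows "x = y \<or> x = reflect y"
proof (cases "i < l")
  case True
  then have "x + real i = y + real w"
    using assms by (simp add: branch_def flip: add_divide_distrib)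
  then have "x - y = real_of_int (int w - int i)" by simp
  moreover have "\<bar>x - y\<bar> \<le> 1" using assms(3,4) by auto
  ultimately have "\<bar>int w - int i\<bar> \<le> 1" by linarith
  then consider "int w - int i = 0" | "int w - int i = 1" | "int w - int i = -1" by linarith
  then show ?thesis
    using \<open>x - y = _\<close> assms(3,4) by cases (auto simp: reflect_def)
next
  case False
  then have "real (i - l) + 1 - x = y + real w"
    using assms by (simp add: branch_def flip: add_divide_distrib diff_divide_distrib)
  then have *: "x + y = real_of_int (int (i - l) + 1 - int w)" by simp
  moreover have "0 \<le> x + y" "x + y \<le> 2" using assms(3,4) by auto
  ultimately have "0 \<le> int (i - l) + 1 - int w" "int (i - l) + 1 - int w \<le> 2" by linarith+
  then consider "int (i - l) + 1 - int w = 0" | "int (i - l) + 1 - int w = 1"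
    | "int (i - l) + 1 - int w = 2" by linarith
  then show ?thesis using * assms(3,4) by cases (auto simp: reflect_def)
qed

lemma reflect_branch:
  assumes "w < l"
  shows "reflect (branch l w x) = branch l (l - 1 - w) (reflect x)"
  using assms by (simp add: branch_def reflect_def field_simps of_nat_diff)

lemma branch_flip_reflect:
  "w < l \<Longrightarrow> branch l (w + l) (reflect x) = branch l w x"
  by (simp add: branch_def reflect_def field_simps)

text \<open>The setting: a self-similar measure for a probability weight that charges all the orientation
  preserving branches.\<close>

locale self_similar = prob_space \<mu> for \<mu> :: "real measure" +
  fixes l :: nat and p :: "nat \<Rightarrow> real"
  assumes l_ge_2: "2 \<le> l"
    and p_nonneg: "\<And>i. i < 2 * l \<Longrightarrow> 0 \<le> p i"
    and p_sum: "(\<Sum>i<2*l. p i) = 1"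
    and p_pos: "\<And>i. i < l \<Longrightarrow> 0 < p i"
    and similar: "self_similar_measure l p \<mu>"
begin

lemma sets_eq: "sets \<mu> = sets borel01"
  using similar by (simp add: self_similar_measure_def)

lemma space_eq: "space \<mu> = {0..1}"
  using sets_eq_imp_space_eq[OF sets_eq] by (simp add: space_borel01)

lemma branch_measurable_self:
  assumes "i < 2 * l"
  shows "branch l i \<in> \<mu> \<rightarrow>\<^sub>M borel01"
  using branch_measurable[OF assms] measurable_cong_sets[OF sets_eq refl] by blast

lemma preimage_sets:
  assumes "i < 2 * l" "A \<in> sets borel01"
  shows "branch l i -` A \<inter> {0..1} \<in> sets \<mu>"
  using measurable_sets[OF branch_measurable_self[OF assms(1)] assms(2)] by (simp add: space_eq)

lemma prob_eq_sum:
  assumes A: "A \<in> sets borel01"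
  shows "prob A = (\<Sum>i<2*l. p i * prob (branch l i -` A \<inter> {0..1}))"
proof -
  have "emeasure \<mu> A = (\<Sum>i<2*l. ennreal (p i) * emeasure (distr \<mu> borel01 (branch l i)) A)"
    using similar A by (simp add: self_similar_measure_def)
  also have "\<dots> = (\<Sum>i<2*l. ennreal (p i * prob (branch l i -` A \<inter> {0..1})))"
  proof (rule sum.cong[OF refl])
    fix i assume "i \<in> {..<2 * l}"
    then show "ennreal (p i) * emeasure (distr \<mu> borel01 (branch l i)) A =
        ennreal (p i * prob (branch l i -` A \<inter> {0..1}))"
      using A p_nonneg[of i]
      by (simp add: emeasure_distr branch_measurable_self space_eq emeasure_eq_measure ennreal_mult)
  qed
  also have "\<dots> = ennreal (\<Sum>i<2*l. p i * prob (branch l i -` A \<inter> {0..1}))"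
    using p_nonneg by (intro sum_ennreal) auto
  finally show ?thesis
    using p_nonneg by (subst (asm) emeasure_eq_measure, subst (asm) ennreal_inj) (auto intro!: sum_nonneg)
qed

text \<open>Of the sum defining \<open>\<mu> (S\<^sub>w A)\<close>, only the two terms with indices \<open>w\<close> and \<open>w + l\<close> are kept.\<close>

lemma prob_branch_image_ge:
  assumes w: "w < l" and A: "A \<in> sets borel01"
  shows "p w * prob A + p (w + l) * prob (reflect ` A) \<le> prob (branch l w ` A)"
proof -
  let ?f = "\<lambda>i. p i * prob (branch l i -` (branch l w ` A) \<inter> {0..1})"
  have A01: "A \<subseteq> {0..1}" "reflect ` A \<subseteq> {0..1}"
    using A reflect_sets[OF A] by (auto simp: sets_borel01)
  note S = branch_sets[OF w A]
  have "prob A \<le> prob (branch l w -` (branch l w ` A) \<inter> {0..1})"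
    using A01 w S by (intro finite_measure_mono preimage_sets) auto
  moreover have "prob (reflect ` A) \<le> prob (branch l (w + l) -` (branch l w ` A) \<inter> {0..1})"
    using A01 w S by (intro finite_measure_mono preimage_sets) (auto simp: branch_flip_reflect)
  ultimately have "p w * prob A + p (w + l) * prob (reflect ` A) \<le> ?f w + ?f (w + l)"
    using w p_nonneg by (intro add_mono mult_left_mono) auto
  also have "\<dots> = sum ?f {w, w + l}" using w by simp
  also have "\<dots> \<le> sum ?f {..<2 * l}"
    using w p_nonneg by (intro sum_mono2) auto
  also have "\<dots> = prob (branch l w ` A)" using prob_eq_sum[OF S] by simp
  finally show ?thesis .
qed

text \<open>By \<open>branch_eq_branch_cases\<close>, every branch preimage of the symmetrized set \<open>S\<^sub>w A \<union> T S\<^sub>w A\<close> lies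
  in \<open>A \<union> T A\<close>; average over the branches.\<close>

lemma prob_branch_symmetric_le:
  assumes w: "w < l" and A: "A \<in> sets borel01"
  shows "prob (branch l w ` A \<union> reflect ` branch l w ` A) \<le> prob (A \<union> reflect ` A)"
proof -
  let ?U = "branch l w ` A \<union> reflect ` branch l w ` A"
  note S = branch_sets[OF w A]
  have U: "?U \<in> sets borel01" using S reflect_sets[OF S] by simp
  have A01: "A \<subseteq> {0..1}" using A by (simp add: sets_borel01)
  have AT: "A \<union> reflect ` A \<in> sets \<mu>" using A reflect_sets[OF A] by (simp add: sets_eq)
  have pre: "branch l i -` ?U \<inter> {0..1} \<subseteq> A \<union> reflect ` A" if i: "i < 2 * l" for i
  proof
    fix x assume "x \<in> branch l i -` ?U \<inter> {0..1}"
    then obtain y where x: "x \<in> {0..1}" and y: "y \<in> A"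
      and "branch l i x = branch l w y \<or> branch l i x = reflect (branch l w y)" by auto
    then consider "branch l i x = branch l w y"
      | "branch l i x = branch l (l - 1 - w) (reflect y)"
      using reflect_branch[OF w] by metis
    then have "x = y \<or> x = reflect y"
    proof cases
      case 1
      then show ?thesis using branch_eq_branch_cases[OF i w x] y A01 by blast
    next
      case 2
      have "reflect y \<in> {0..1}" using y A01 by (auto simp: reflect_def)
      then have "x = reflect y \<or> x = reflect (reflect y)"
        using branch_eq_branch_cases[OF i _ x _ 2] w by simp
      then show ?thesis by (auto simp: reflect_def)
    qed
    then show "x \<in> A \<union> reflect ` A" using y by blast
  qed
  have "prob ?U = (\<Sum>i<2*l. p i * prob (branch l i -` ?U \<inter> {0..1}))"
    by (rule prob_eq_sum[OF U])
  also have "\<dots> \<le> (\<Sum>i<2*l. p i * prob (A \<union> reflect ` A))"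
    using p_nonneg pre AT by (intro sum_mono mult_left_mono finite_measure_mono) auto
  also have "\<dots> = prob (A \<union> reflect ` A)"
    using p_sum by (simp flip: sum_distrib_right)
  finally show ?thesis .
qed

text \<open>Induction on the position \<open>k\<close> of a digit \<open>w\<close> with \<open>p\<^bsub>w+l\<^esub> \<noteq> 0\<close>, peeling off first digits. The
  interval is compared with its union with the mirror image, as this is the quantity that
  \<open>prob_branch_symmetric_le\<close> controls.\<close>

lemma self_similar_comparable_at:
  assumes "x \<in> {0..1}" "first_digit l ((digit_shift l ^^ k) x) \<notin> zero_flip_digits l p"
  shows "\<exists>c>0. \<forall>n. let J = adic_interval_at l (n + Suc k) x
    in c * prob (J \<union> reflect ` J) \<le> prob J"
  using assms
proof (induction k arbitrary: x)
  case 0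
  define w where "w = first_digit l x"
  define c where "c = min (p w) (p (w + l))"
  have w: "w < l" using first_digit_less 0(1) l_ge_2 by (simp add: w_def)
  have "p (w + l) \<noteq> 0" using 0(2) w by (simp add: zero_flip_digits_def w_def)
  then have "0 < c" using p_nonneg[of "w + l"] p_pos[of w] w by (simp add: c_def)
  have bound: "c * prob (J \<union> reflect ` J) \<le> prob J" if J: "J = adic_interval_at l (Suc n) x" for n J
  proof -
    define A where "A = adic_interval_at l n (digit_shift l x)"
    have A: "A \<in> sets borel01"
      using digit_shift_mem[of l x] 0(1) l_ge_2 by (simp add: A_def adic_interval_at_sets)
    have JA: "J = branch l w ` A" using adic_interval_at_Suc 0(1) l_ge_2 by (simp add: J A_def w_def)
    have "c * prob (J \<union> reflect ` J) \<le> c * prob (A \<union> reflect ` A)"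
      using prob_branch_symmetric_le[OF w A] \<open>0 < c\<close> by (simp add: JA)
    also have "\<dots> \<le> c * (prob A + prob (reflect ` A))"
      using A reflect_sets[OF A] \<open>0 < c\<close>
      by (intro mult_left_mono measure_Un_le) (auto simp: sets_eq)
    also have "\<dots> \<le> p w * prob A + p (w + l) * prob (reflect ` A)"
      unfolding distrib_left by (intro add_mono mult_right_mono) (auto simp: c_def)
    also have "\<dots> \<le> prob J" using prob_branch_image_ge[OF w A] by (simp add: JA)
    finally show ?thesis .
  qed
  show ?case using \<open>0 < c\<close> bound by (auto simp: Let_def)
next
  case (Suc k)
  define w where "w = first_digit l x"
  have w: "w < l" using first_digit_less Suc.prems(1) l_ge_2 by (simp add: w_def)
  have y: "digit_shift l x \<in> {0..1}" using digit_shift_mem Suc.prems(1) l_ge_2 by simp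
  have "first_digit l ((digit_shift l ^^ k) (digit_shift l x)) \<notin> zero_flip_digits l p"
    using Suc.prems(2) by (simp only: funpow_Suc_right o_apply not_False_eq_True)
  from Suc.IH[OF y this] obtain c where c: "0 < c"
    "\<And>n A. A = adic_interval_at l (n + Suc k) (digit_shift l x) \<Longrightarrow>
      c * prob (A \<union> reflect ` A) \<le> prob A" by (auto simp: Let_def)
  have bound: "p w * c * prob (J \<union> reflect ` J) \<le> prob J"
    if J: "J = adic_interval_at l (n + Suc (Suc k)) x" for n J
  proof -
    define A where "A = adic_interval_at l (n + Suc k) (digit_shift l x)"
    have A: "A \<in> sets borel01"
      using y l_ge_2 by (simp add: A_def adic_interval_at_sets)
    have JA: "J = branch l w ` A"
      using adic_interval_at_Suc[of l x "n + Suc k"] Suc.prems(1) l_ge_2 by (simp add: J A_def w_def)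
    have "p w * c * prob (J \<union> reflect ` J) \<le> p w * (c * prob (A \<union> reflect ` A))"
      using prob_branch_symmetric_le[OF w A] c(1) p_pos[OF w] by (simp add: JA)
    also have "\<dots> \<le> p w * prob A"
      using c(2)[OF A_def] p_pos[OF w] by simp
    also have "\<dots> \<le> p w * prob A + p (w + l) * prob (reflect ` A)"
      using p_nonneg[of "w + l"] w by simp
    also have "\<dots> \<le> prob J" using prob_branch_image_ge[OF w A] by (simp add: JA)
    finally show ?thesis .
  qed
  show ?case
    using bound c(1) p_pos[OF w] by (intro exI[of _ "p w * c"]) (auto simp: Let_def)
qed

lemma measure_symmetrization:
  assumes A: "A \<in> sets borel01"
  shows "measure (symmetrization \<mu>) A = (prob A + prob (reflect ` A)) / 2"
proof -
  have "emeasure (symmetrization \<mu>) A = ennreal ((prob A + prob (reflect ` A)) / 2)"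
    using emeasure_symmetrization[OF sets_eq A]
    by (simp add: emeasure_eq_measure divide_ennreal flip: ennreal_plus ennreal_numeral)
  then show ?thesis by (simp add: measure_def)
qed

end

section \<open>Decay rates of comparable sequences\<close>

text \<open>The logarithms of comparable sequences differ by a bounded amount, which is negligible after
  division by \<open>n\<close>. Because the limit is finite, \<open>a n\<close> is eventually nonzero and the extended real
  convention for \<open>- log 0\<close> plays no role.\<close>

lemma neg_log_rate_cong:
  fixes a b :: "nat \<Rightarrow> real"
  assumes L: "0 < L" and c: "0 < c" "0 < d"
    and ab: "\<forall>\<^sub>F n in sequentially. c * a n \<le> b n \<and> b n \<le> d * a n"
    and nonneg: "\<And>n. 0 \<le> a n"
    and lim: "(\<lambda>n. neg_log (a n) / ereal (real n * L)) \<longlonglongrightarrow> ereal \<alpha>"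
  shows "(\<lambda>n. neg_log (b n) / ereal (real n * L)) \<longlonglongrightarrow> ereal \<alpha>"
proof -
  define u where "u n = - ln (a n) / (real n * L)" for n
  define v where "v n = - ln (b n) / (real n * L)" for n
  define C where "C = \<bar>ln c\<bar> + \<bar>ln d\<bar>"
  have pos: "\<forall>\<^sub>F n in sequentially. 0 < a n \<and> 0 < n"
  proof -
    have "\<forall>\<^sub>F n in sequentially. neg_log (a n) / ereal (real n * L) < \<infinity>"
      using lim by (rule order_tendstoD(2)) simp
    with eventually_gt_at_top[of 0] show ?thesis
    proof eventually_elim
      case (elim n)
      then have "a n \<noteq> 0" using L by (auto simp: neg_log_def)
      then show ?case using nonneg[of n] elim by simp
    qed
  qed
  have "\<forall>\<^sub>F n in sequentially. neg_log (a n) / ereal (real n * L) = ereal (u n)"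
    using pos by eventually_elim (use L in \<open>simp add: neg_log_def u_def\<close>)
  with lim have u: "u \<longlonglongrightarrow> \<alpha>"
    using tendsto_cong by force
  have "\<forall>\<^sub>F n in sequentially. norm (v n - u n) \<le> C / L * inverse (real n)"
    using pos ab
  proof eventually_elim
    case (elim n)
    then have b: "0 < b n" using c(1) by (meson less_le_trans mult_pos_pos)
    have "ln c + ln (a n) \<le> ln (b n)"
      using elim b c by (metis ln_mult_pos ln_mono mult_pos_pos)
    moreover have "ln (b n) \<le> ln d + ln (a n)"
      using elim b c by (metis ln_mult_pos ln_mono mult_pos_pos)
    ultimately have "\<bar>ln (a n) - ln (b n)\<bar> \<le> C" by (simp add: C_def)
    then have "\<bar>ln (a n) - ln (b n)\<bar> / (real n * L) \<le> C / (real n * L)"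
      using L by (intro divide_right_mono) auto
    moreover have "v n - u n = (ln (a n) - ln (b n)) / (real n * L)"
      by (simp add: u_def v_def diff_divide_distrib)
    ultimately show ?case using L by (simp add: abs_mult divide_inverse mult.commute mult.left_commute)
  qed
  moreover have "(\<lambda>n. C / L * inverse (real n)) \<longlonglongrightarrow> 0"
    by (intro tendsto_mult_right_zero lim_inverse_n)
  ultimately have "(\<lambda>n. v n - u n) \<longlonglongrightarrow> 0" by (rule Lim_null_comparison)
  from tendsto_add[OF this u] have "(\<lambda>n. ereal (v n)) \<longlonglongrightarrow> ereal \<alpha>" by simp
  moreover have "\<forall>\<^sub>F n in sequentially. neg_log (b n) / ereal (real n * L) = ereal (v n)"
    using pos ab
  proof eventually_elim
    case (elim n)
    then have "0 < b n" using c(1) by (meson less_le_trans mult_pos_pos)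
    then show ?case using L elim by (simp add: neg_log_def v_def)
  qed
  ultimately show ?thesis using tendsto_cong by force
qed

theorem proposition5p1:
  fixes l :: nat and p :: "nat \<Rightarrow> real" and \<mu> \<nu> :: "real measure"
    and B :: "nat set" and K :: "real set" and \<alpha> :: real
  assumes "2 \<le> l"
    and "\<And>i. i < 2 * l \<Longrightarrow> 0 \<le> p i"
    and "(\<Sum>i<2*l. p i) = 1"
    and "\<And>i. i < l \<Longrightarrow> 0 < p i"
    and "self_similar_measure l p \<mu>"
    and "\<nu> = symmetrization \<mu>"
    and "B = zero_flip_digits l p"
    and "is_attractor l B K"
    and "0 < \<alpha>"
  shows "level_set l \<mu> \<alpha> =
           (level_set l \<nu> \<alpha> \<inter> ({0..1} - K)) \<union> (level_set l \<mu> \<alpha> \<inter> K)"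
proof -
  interpret self_similar \<mu> l p
    using assms(1-5) by (simp add: self_similar_def self_similar_axioms_def self_similar_measure_def)
  have same: "x \<in> level_set l \<mu> \<alpha> \<longleftrightarrow> x \<in> level_set l \<nu> \<alpha>" if x: "x \<in> {0..1}" "x \<notin> K" for x
  proof -
    have "B \<subseteq> {..<l}" by (auto simp: assms(7) zero_flip_digits_def)
    then obtain k where "first_digit l ((digit_shift l ^^ k) x) \<notin> B"
      using attractor_mem_if_digits[OF assms(1,8) _ x(1)] x(2) by blast
    then obtain c where c: "0 < c" "\<And>n J. J = adic_interval_at l (n + Suc k) x \<Longrightarrow>
        c * prob (J \<union> reflect ` J) \<le> prob J"
      using self_similar_comparable_at[OF x(1)] by (auto simp: Let_def assms(7))
    let ?m = "\<lambda>n. prob (adic_interval_at l n x)"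
    let ?v = "\<lambda>n. measure \<nu> (adic_interval_at l n x)"
    have ev: "\<forall>\<^sub>F n in sequentially. c * ?v n \<le> ?m n \<and> ?m n \<le> 2 * ?v n"
      using eventually_ge_at_top[of "Suc k"]
    proof eventually_elim
      case (elim n)
      define J where "J = adic_interval_at l n x"
      have J: "J \<in> sets borel01"
        using x(1) assms(1) by (simp add: J_def adic_interval_at_sets)
      have TJ: "reflect ` J \<in> sets borel01" using reflect_sets[OF J] .
      have v: "?v n = (prob J + prob (reflect ` J)) / 2"
        using measure_symmetrization[OF J] by (simp add: assms(6) J_def)
      have "prob J \<le> prob (J \<union> reflect ` J)" "prob (reflect ` J) \<le> prob (J \<union> reflect ` J)"
        using J TJ by (auto intro!: finite_measure_mono simp: sets_eq)
      then have "c * ?v n \<le> c * prob (J \<union> reflect ` J)"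
        using c(1) by (simp add: v)
      also have "\<dots> \<le> prob J" using c(2)[of J "n - Suc k"] elim by (simp add: J_def)
      finally have "c * ?v n \<le> prob J" .
      moreover have "prob J \<le> 2 * ?v n" by (simp add: v)
      ultimately show ?case by (simp add: J_def)
    qed
    have ev': "\<forall>\<^sub>F n in sequentially. 1 / 2 * ?m n \<le> ?v n \<and> ?v n \<le> 1 / c * ?m n"
      using ev by eventually_elim (use c(1) in \<open>simp add: field_simps\<close>)
    have L: "0 < ln (real l)" using assms(1) by simp
    show ?thesis
      using neg_log_rate_cong[OF L c(1) _ ev] neg_log_rate_cong[OF L _ _ ev'] c(1) x(1)
      unfolding level_set_def by auto
  qed
  have "level_set l \<mu> \<alpha> \<subseteq> {0..1}" by (auto simp: level_set_def)
  with same show ?thesis by blast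
qed

end
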